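(* Let $m_1,m_2,m_3>0$ be three positive masses and let $L$ be a $4\times 4$ antisymmetric real matrix of rank $4$. Consider the Newtonian 3-body problem in $\mathbb{R}^4$ with these masses and, in its phase space, the submanifold of states whose angular momentum is equal to $L$. Then on this submanifold the energy $H$ is bounded below by a negative number $H_0$.
   Context: The bodies have positions $q_i\in\mathbb{R}^4$ (pairwise distinct) and momenta $p_i=m_i\dot q_i\in\mathbb{R}^4$, $i=1,2,3$. The centre of mass is fixed at the origin: $\sum_i m_i q_i=0$ and $\sum_i p_i=0$. The energy (Hamiltonian) is $H=\frac12\sum_{i=1}^3 \frac{|p_i|^2}{m_i}-\sum_{i<j}\frac{m_im_j}{|q_i-q_j|}$, and the angular momentum is the antisymmetric matrix $\sum_{i=1}^3 (q_ip_i^t-p_iq_i^t)$. *)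

theory Defs
  imports "HOL-Analysis.Analysis"
begin

text \<open>
  The bodies are indexed by the three-element type \<open>3\<close> (whose elements are \<open>1\<close>, \<open>2\<close> and \<open>3 = 0\<close>);
  a state is a pair of position and momentum configurations.
\<close>

type_synonym config = "3 \<Rightarrow> real^4"
type_synonym state = "config \<times> config"

definition phase_space :: "(3 \<Rightarrow> real) \<Rightarrow> state set" where
  "phase_space m =
     {(q, p). inj q \<and> (\<Sum>i\<in>UNIV. m i *\<^sub>R q i) = 0 \<and> (\<Sum>i\<in>UNIV. p i) = 0}"

text \<open>
  Each unordered pair of bodies occurs exactly once in the potential.  The linear order on the
  index type puts \<open>3 = 0\<close> first, which is harmless since the summand is symmetric.
\<close>

definition energy :: "(3 \<Rightarrow> real) \<Rightarrow> state \<Rightarrow> real" where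
  "energy m = (\<lambda>(q, p).
     (\<Sum>i\<in>UNIV. (norm (p i))\<^sup>2 / m i) / 2
     - (\<Sum>(i, j)\<in>{(i, j). i < j}. m i * m j / norm (q i - q j)))"

definition outer :: "real^'n \<Rightarrow> real^'m \<Rightarrow> real^'m^'n" where
  "outer x y = (\<chi> r c. x $ r * y $ c)"

definition angular_momentum :: "state \<Rightarrow> real^4^4" where
  "angular_momentum = (\<lambda>(q, p).
     \<Sum>i\<in>UNIV. outer (q i) (p i) - outer (p i) (q i))"

definition momentum_level :: "(3 \<Rightarrow> real) \<Rightarrow> real^4^4 \<Rightarrow> state set" where
  "momentum_level m L = {s \<in> phase_space m. angular_momentum s = L}"

end

theory Submission
  imports Defs
begin

text \<open>
  The only danger for a lower bound is the potential \<open>- m\<^sub>i m\<^sub>j / |q\<^sub>i - q\<^sub>j|\<close> of a close pair, and the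
  theorem holds because an angular momentum of rank \<open>4\<close> forces a close pair to have a large kinetic
  energy \<open>K\<close>.  Consider a pair \<open>i, j\<close> and let \<open>k\<close> be the third body.  In \<open>\<real>\<^sup>4\<close> there is a
  vector \<open>v \<noteq> 0\<close> orthogonal to both \<open>q\<^sub>k\<close> and \<open>p\<^sub>k\<close>.  The third body does not contribute
  to \<open>L v\<close>, and, since the centre of mass is at rest at the origin, what remains is the action on \<open>v\<close>
  of the relative motion of the pair alone (\<open>angular_momentum_times_orthogonal_to_third\<close>).  Its size
  is at most a constant times \<open>|q\<^sub>i - q\<^sub>j| \<surd>K |v|\<close>, whereas \<open>L\<close> is injective, so that
  \<open>|L v| \<ge> b |v|\<close> for some \<open>b > 0\<close>.  Hence \<open>1 / |q\<^sub>i - q\<^sub>j|\<close> is at most a constant times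
  \<open>\<surd>K\<close> (\<open>inverse_distance_bound\<close>).

  Summed over the pairs this gives \<open>H \<ge> K - D \<surd>K\<close>, where \<open>D\<close> depends only on the masses and
  on \<open>L\<close>, and \<open>K - D \<surd>K = (\<surd>K - D/2)\<^sup>2 - D\<^sup>2/4\<close> is at least \<open>- D\<^sup>2/4\<close>.
\<close>

definition kinetic_energy :: "(3 \<Rightarrow> real) \<Rightarrow> config \<Rightarrow> real" where
  "kinetic_energy m p = (\<Sum>i\<in>UNIV. (norm (p i))\<^sup>2 / m i) / 2"

lemma outer_vector_mult: "outer x y *v v = (y \<bullet> v) *\<^sub>R x"
  by (simp add: vec_eq_iff outer_def matrix_vector_mult_def inner_vec_def sum_distrib_left
      mult_ac)

lemma angular_momentum_vector_mult:
  "angular_momentum (q, p) *v v = (\<Sum>i\<in>UNIV. (p i \<bullet> v) *\<^sub>R q i - (q i \<bullet> v) *\<^sub>R p i)"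
  by (simp add: angular_momentum_def sum_3 matrix_vector_mult_add_rdistrib
      matrix_vector_mult_diff_rdistrib outer_vector_mult)

lemma third_body_exists:
  fixes i j :: 3
  assumes "i \<noteq> j"
  obtains k where "k \<noteq> i" "k \<noteq> j" "UNIV = {i, j, k}"
proof -
  have "\<exists>k. k \<noteq> i \<and> k \<noteq> j \<and> (\<forall>l. l = i \<or> l = j \<or> l = k)"
    using assms exhaust_3[of i] exhaust_3[of j] by (auto simp: forall_3)
  then show thesis
    using that by blast
qed

lemma norm_momentum_le:
  assumes "\<And>i. m i > 0"
  shows "norm (p i) \<le> sqrt (2 * sum m UNIV) * sqrt (kinetic_energy m p)"
proof -
  have "(norm (p i))\<^sup>2 / m i \<le> (\<Sum>i\<in>UNIV. (norm (p i))\<^sup>2 / m i)"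
    by (rule member_le_sum) (auto simp: assms less_imp_le)
  then have le: "(norm (p i))\<^sup>2 / m i \<le> 2 * kinetic_energy m p"
    by (simp add: kinetic_energy_def)
  have "0 \<le> (norm (p i))\<^sup>2 / m i"
    using assms[of i] by simp
  then have K: "0 \<le> kinetic_energy m p"
    using le by linarith
  have "(norm (p i))\<^sup>2 \<le> m i * (2 * kinetic_energy m p)"
    using le assms[of i] by (simp add: field_simps)
  also have "\<dots> \<le> sum m UNIV * (2 * kinetic_energy m p)"
    using K by (intro mult_right_mono member_le_sum) (auto simp: assms less_imp_le)
  also have "\<dots> = (2 * sum m UNIV) * kinetic_energy m p"
    by simp
  finally show ?thesis
    by (simp flip: real_sqrt_mult add: real_le_rsqrt)
qed

text \<open>
  Along a direction orthogonal to the position and the momentum of the third body, the first two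
  bodies look like a two-body problem whose centre of mass is at rest at the origin: their momenta
  and their mass-weighted positions have opposite components.  This makes their contributions to
  \<open>L v\<close> combine into the relative position \<open>q i - q j\<close> and the relative momentum
  \<open>(m j p i - m i p j) / (m i + m j)\<close>.
\<close>

lemma angular_momentum_times_orthogonal_to_third:
  fixes v :: "real^4"
  assumes pos: "\<And>i. m i > 0" and state: "(q, p) \<in> phase_space m"
    and bodies: "i \<noteq> j" "k \<noteq> i" "k \<noteq> j" "UNIV = {i, j, k}"
    and orth: "q k \<bullet> v = 0" "p k \<bullet> v = 0"
  shows "angular_momentum (q, p) *v v =
    (p i \<bullet> v) *\<^sub>R (q i - q j)
    - ((q i - q j) \<bullet> v) *\<^sub>R ((m j / (m i + m j)) *\<^sub>R p i - (m i / (m i + m j)) *\<^sub>R p j)"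
proof -
  have sum: "sum f UNIV = f i + f j + f k" for f :: "3 \<Rightarrow> real^4"
    unfolding bodies(4) using bodies(1-3) by (simp add: add.assoc)
  have "m i *\<^sub>R q i + m j *\<^sub>R q j + m k *\<^sub>R q k = 0" "p i + p j + p k = 0"
    using state unfolding phase_space_def sum by auto
  from arg_cong[OF this(1), of "\<lambda>x. x \<bullet> v"] arg_cong[OF this(2), of "\<lambda>x. x \<bullet> v"]
  have q: "m i * (q i \<bullet> v) + m j * (q j \<bullet> v) = 0" and p: "p j \<bullet> v = - (p i \<bullet> v)"
    using orth by (simp_all add: inner_add_left)
  have M: "m i + m j \<noteq> 0"
    using pos[of i] pos[of j] by simp
  have qi: "q i \<bullet> v = ((q i - q j) \<bullet> v) * (m j / (m i + m j))"
    using q M by (simp add: field_simps inner_diff_left)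
  have qj: "q j \<bullet> v = - ((q i - q j) \<bullet> v) * (m i / (m i + m j))"
    using q M by (simp add: field_simps inner_diff_left)
  have "angular_momentum (q, p) *v v =
      (p i \<bullet> v) *\<^sub>R q i + (p j \<bullet> v) *\<^sub>R q j - ((q i \<bullet> v) *\<^sub>R p i + (q j \<bullet> v) *\<^sub>R p j)"
    by (simp add: angular_momentum_vector_mult sum orth)
  also have "\<dots> = (p i \<bullet> v) *\<^sub>R (q i - q j)
      - ((q i - q j) \<bullet> v) *\<^sub>R ((m j / (m i + m j)) *\<^sub>R p i - (m i / (m i + m j)) *\<^sub>R p j)"
    unfolding p qi qj
    by (simp add: algebra_simps)
  finally show ?thesis .
qed

text \<open>
  Dimension \<open>4\<close> enters here: two vectors of \<open>\<real>\<^sup>4\<close>, the position and the momentum of the third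
  body, always leave an orthogonal direction, on which only the relative motion of the pair can
  account for the lower bound on \<open>L v\<close>.
\<close>

lemma inverse_distance_bound:
  assumes pos: "\<And>i. m i > 0" and state: "(q, p) \<in> phase_space m" and "i \<noteq> j"
    and b: "0 < b" "\<And>v. b * norm v \<le> norm (angular_momentum (q, p) *v v)"
  shows "1 / norm (q i - q j) \<le> 3 * sqrt (2 * sum m UNIV) / b * sqrt (kinetic_energy m p)"
proof -
  obtain k where k: "k \<noteq> i" "k \<noteq> j" "UNIV = {i, j, k}"
    using third_body_exists[OF \<open>i \<noteq> j\<close>] .
  have "dim {q k, p k} \<le> card {q k, p k}"
    by (intro dim_le_card') simp
  also have "\<dots> \<le> 2"
    by (simp add: card_insert_if)
  also have "2 < DIM(real^4)"
    by simp
  finally have "dim {q k, p k} < DIM(real^4)" .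
  then obtain v where "v \<noteq> 0" and v: "\<And>y. y \<in> span {q k, p k} \<Longrightarrow> orthogonal v y"
    using orthogonal_to_subspace_exists by blast
  have orth: "q k \<bullet> v = 0" "p k \<bullet> v = 0"
    using v[of "q k"] v[of "p k"] by (auto simp: orthogonal_def inner_commute span_base)
  define P where "P = sqrt (2 * sum m UNIV) * sqrt (kinetic_energy m p)"
  define \<xi> where "\<xi> = (m j / (m i + m j)) *\<^sub>R p i - (m i / (m i + m j)) *\<^sub>R p j"
  have P: "norm (p l) \<le> P" for l
    unfolding P_def by (rule norm_momentum_le[OF pos])
  have "norm (a *\<^sub>R p l) \<le> P" if "0 \<le> a" "a \<le> 1" for a l
    using P[of l] mult_right_mono[OF that(2), of "norm (p l)"] that(1) by simp
  from this[of "m j / (m i + m j)" i] this[of "m i / (m i + m j)" j]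
  have "norm ((m j / (m i + m j)) *\<^sub>R p i) \<le> P" "norm ((m i / (m i + m j)) *\<^sub>R p j) \<le> P"
    using pos[of i] pos[of j] by simp_all
  then have \<xi>: "norm \<xi> \<le> 2 * P"
    unfolding \<xi>_def by (smt (verit) norm_triangle_ineq4)
  have "b * norm v \<le> norm ((p i \<bullet> v) *\<^sub>R (q i - q j) - ((q i - q j) \<bullet> v) *\<^sub>R \<xi>)"
    using b(2)[of v]
    unfolding angular_momentum_times_orthogonal_to_third[OF pos state \<open>i \<noteq> j\<close> k orth] \<xi>_def .
  also have "\<dots> \<le> \<bar>p i \<bullet> v\<bar> * norm (q i - q j) + \<bar>(q i - q j) \<bullet> v\<bar> * norm \<xi>"
    by (metis norm_scaleR norm_triangle_ineq4)
  also have "\<dots> \<le> (P * norm v) * norm (q i - q j) + (norm (q i - q j) * norm v) * (2 * P)"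
    using order_trans[OF Cauchy_Schwarz_ineq2 mult_right_mono[OF P]] \<xi>
      order_trans[OF norm_ge_zero P]
    by (intro add_mono mult_mono Cauchy_Schwarz_ineq2) auto
  also have "\<dots> = (3 * P * norm (q i - q j)) * norm v"
    by (simp add: algebra_simps)
  finally have "b \<le> 3 * P * norm (q i - q j)"
    using \<open>v \<noteq> 0\<close> by simp
  moreover have "0 < norm (q i - q j)"
    using state \<open>i \<noteq> j\<close> by (auto simp: phase_space_def inj_def)
  ultimately show ?thesis
    using b(1) by (simp add: P_def field_simps)
qed

theorem proposition7:
  fixes m :: "3 \<Rightarrow> real" and L :: "real^4^4"
  assumes "\<And>i. m i > 0"
    and "transpose L = - L"
    and "rank L = 4"
  shows "\<exists>H\<^sub>0<0. \<forall>s\<in>momentum_level m L. H\<^sub>0 \<le> energy m s"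
proof -
  have "inj ((*v) L)"
    using assms(3) by (simp flip: full_rank_injective)
  then obtain b where b: "0 < b" "\<And>v. b * norm v \<le> norm (L *v v)"
    using linear_inj_bounded_below_pos[OF matrix_vector_mul_linear, of L] by metis
  define C where "C = 3 * sqrt (2 * sum m UNIV) / b"
  define D where "D = (\<Sum>(i, j)\<in>{(i, j). i < j}. m i * m j) * C"
  have "- (D\<^sup>2 / 4) - 1 \<le> energy m s" if "s \<in> momentum_level m L" for s
  proof -
    obtain q p where s: "s = (q, p)"
      by fastforce
    have state: "(q, p) \<in> phase_space m" and L: "angular_momentum (q, p) = L"
      using that by (auto simp: momentum_level_def s)
    define K where "K = kinetic_energy m p"
    have "0 \<le> K"
      unfolding K_def kinetic_energy_def
      using assms(1) by (simp add: sum_nonneg less_imp_le)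
    have "m i * m j / norm (q i - q j) \<le> m i * m j * C * sqrt K" if "i < j" for i j
    proof -
      have "1 / norm (q i - q j) \<le> C * sqrt K"
        using inverse_distance_bound[OF assms(1) state, of i j b] b that
        by (simp add: L C_def K_def)
      from mult_left_mono[OF this, of "m i * m j"] show ?thesis
        using assms(1)[of i] assms(1)[of j] by (simp add: mult.assoc)
    qed
    then have "(\<Sum>(i, j)\<in>{(i, j). i < j}. m i * m j / norm (q i - q j))
        \<le> (\<Sum>(i, j)\<in>{(i, j). i < j}. m i * m j * C * sqrt K)"
      by (intro sum_mono) auto
    also have "\<dots> = D * sqrt K"
      by (simp add: D_def sum_distrib_right case_prod_unfold)
    finally have "K - D * sqrt K \<le> energy m s"
      by (simp add: energy_def s K_def kinetic_energy_def)
    moreover have "K - D * sqrt K = (sqrt K - D / 2)\<^sup>2 - D\<^sup>2 / 4"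
      using \<open>0 \<le> K\<close> by (simp add: power2_diff power_divide algebra_simps)
    ultimately show ?thesis
      using zero_le_power2[of "sqrt K - D / 2"] by linarith
  qed
  moreover have "- (D\<^sup>2 / 4) - 1 < 0"
    using zero_le_power2[of D] by linarith
  ultimately show ?thesis
    by blast
qed

end
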